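(* Let $p(x)=40x^4-30x^2+2$ and $q(x)=75x^9-150x^7+88x^5-10x^3-3x$, and consider the polynomial Abel differential equation \[ \frac{dy}{dx}=p(x)\,y^2+q(x)\,y^3 \] on the interval $[a,b]=[-1,1]$. Then this equation has a center in $[-1,1]$, and it does not satisfy the composition condition.
   Context: For real polynomials $p,q\in\mathbb{R}[x]$ and a real interval $[a,b]$, the polynomial Abel equation $dy/dx=p(x)y^2+q(x)y^3$ (with $y$ real) has a center in $[a,b]$ if there is a neighborhood of $0$ such that every solution $y(x)$ with $y(a)$ in this neighborhood is defined on $[a,b]$ and satisfies $y(a)=y(b)$. For a continuous function $c$, write $\tilde c(x)=\int_a^x c(\sigma)\,d\sigma$. The equation satisfies the composition condition on $[a,b]$ if there exist real polynomials $w,p_1,q_1\in\mathbb{R}[x]$ with $w(a)=w(b)$ such that $\tilde p(x)=p_1(w(x))$ and $\tilde q(x)=q_1(w(x))$ for all $x$. Here $a=-1$, $b=1$. *)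

theory Defs
  imports "HOL-Analysis.Analysis" "HOL-Computational_Algebra.Polynomial"
begin

definition abel_solution_on ::
  "real poly \<Rightarrow> real poly \<Rightarrow> real \<Rightarrow> real \<Rightarrow> (real \<Rightarrow> real) \<Rightarrow> bool" where
  "abel_solution_on p q a b y \<longleftrightarrow>
     (\<forall>x\<in>{a..b}. (y has_real_derivative
         (poly p x * (y x)^2 + poly q x * (y x)^3)) (at x within {a..b}))"

definition abel_center ::
  "real poly \<Rightarrow> real poly \<Rightarrow> real \<Rightarrow> real \<Rightarrow> bool" where
  "abel_center p q a b \<longleftrightarrow>
     (\<exists>\<epsilon>>0. \<forall>y0. \<bar>y0\<bar> < \<epsilon> \<longrightarrow>
        (\<exists>y. abel_solution_on p q a b y \<and> y a = y0) \<and>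
        (\<forall>y. abel_solution_on p q a b y \<and> y a = y0 \<longrightarrow> y b = y a))"

definition tilde :: "(real \<Rightarrow> real) \<Rightarrow> real \<Rightarrow> real \<Rightarrow> real" where
  "tilde c a x = (if a \<le> x then integral {a..x} c else - integral {x..a} c)"

definition composition_condition ::
  "real poly \<Rightarrow> real poly \<Rightarrow> real \<Rightarrow> real \<Rightarrow> bool" where
  "composition_condition p q a b \<longleftrightarrow>
     (\<exists>w p1 q1 :: real poly. poly w a = poly w b \<and>
        (\<forall>x. tilde (poly p) a x = poly p1 (poly w x)) \<and>
        (\<forall>x. tilde (poly q) a x = poly q1 (poly w x)))"

end

theory Submission
  imports Defs "HOL-Computational_Algebra.Primes"
begin

text \<open>
  Put \<open>P(x) = 8x^5 - 10x^3 + 2x\<close>, the primitive of \<open>p\<close> vanishing at \<open>-1\<close>, and \<open>u = 1/y + P(x)\<close>.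
  Then \<open>(u - P) du/dx = -q\<close>, and this equation has two invariant curves \<open>f = 0\<close>, \<open>g = 0\<close>, both
  quadratic in \<open>u\<close>, whose cofactors \<open>18x^2 - 30x^4\<close> and \<open>24x^2 - 40x^4\<close> are in the ratio 3:4. Hence
  \<open>f^4 / g^3\<close> is a rational first integral. At \<open>x = -1\<close> and \<open>x = 1\<close> both \<open>f\<close> and \<open>g\<close> reduce to \<open>u^2\<close>
  and \<open>u = 1/y\<close>, so the first integral is \<open>1/y^2\<close> there and \<open>y(1)^2 = y(-1)^2\<close>. With
  \<open>F = y^2 f\<close> and \<open>G = y^2 g\<close>, polynomial in \<open>x\<close> and \<open>y\<close>, its reciprocal is \<open>y^2 G^3 / F^4\<close>, which vanishes
  where \<open>y\<close> does; so a nonzero small solution cannot change sign.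

  If the composition condition held, \<open>deg P = 5\<close> being prime and \<open>w(-1) = w(1)\<close> would force \<open>p\<^sub>1\<close> to be
  affine, so \<open>P\<close> would determine \<open>w\<close> and hence the primitive of \<open>q\<close>. But \<open>P(0) = P(1)\<close>, while the
  primitive of \<open>q\<close> takes different values at 0 and 1.
\<close>

section \<open>Invariant curves and the rational first integral\<close>

text \<open>
  This is \<open>y^2 (u^2 + A u + C)\<close> for \<open>u = 1/y + P\<close>; the hypotheses on \<open>A\<close> and \<open>C\<close> in the next lemma
  say that \<open>u^2 + A u + C = 0\<close> is an invariant curve with cofactor \<open>k\<close> of \<open>x' = u - P\<close>, \<open>u' = -q\<close>.
\<close>

definition abel_quadric :: "(real \<Rightarrow> real) \<Rightarrow> (real \<Rightarrow> real) \<Rightarrow> (real \<Rightarrow> real) \<Rightarrow> real \<Rightarrow> real \<Rightarrow> real" where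
  "abel_quadric P A C x y = (1 + P x * y)^2 + A x * y * (1 + P x * y) + C x * y^2"

lemma abel_quadric_invariant:
  fixes P A C y :: "real \<Rightarrow> real" and p q k x :: real
  assumes y: "(y has_real_derivative p * y x^2 + q * y x^3) (at x within S)"
    and P: "(P has_real_derivative p) (at x within S)"
    and A: "(A has_real_derivative k) (at x within S)"
    and C: "(C has_real_derivative C') (at x within S)" "C' = k * (P x + A x) + 2 * q"
    and res: "P x * C' + q * A x + k * C x = 0"
  shows "((\<lambda>x. abel_quadric P A C x (y x)) has_real_derivative
     (2 * (p * y x + q * y x^2) + k * y x) * abel_quadric P A C x (y x)) (at x within S)"
proof -
  have "((\<lambda>x. abel_quadric P A C x (y x)) has_real_derivative
     2 * (p * y x + P x * (p * y x^2 + q * y x^3)) * (1 + P x * y x)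
     + (k * y x + A x * (p * y x^2 + q * y x^3)) * (1 + P x * y x)
     + A x * y x * (p * y x + P x * (p * y x^2 + q * y x^3))
     + C' * y x^2 + C x * (2 * y x * (p * y x^2 + q * y x^3))) (at x within S)"
    unfolding abel_quadric_def
    by (rule derivative_eq_intros y P A C(1) refl | simp add: algebra_simps)+
  \<comment> \<open>\<open>2 * (p * y x + q * y x^2)\<close> is the logarithmic derivative of
    \<open>y^2\<close>; the cofactor acquires a factor \<open>y x\<close> because x' = u - P =
    1/y.\<close>
  also have "2 * (p * y x + P x * (p * y x^2 + q * y x^3)) * (1 + P x * y x)
     + (k * y x + A x * (p * y x^2 + q * y x^3)) * (1 + P x * y x)
     + A x * y x * (p * y x + P x * (p * y x^2 + q * y x^3))
     + C' * y x^2 + C x * (2 * y x * (p * y x^2 + q * y x^3))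
     = (2 * (p * y x + q * y x^2) + k * y x) * abel_quadric P A C x (y x)"
    using C(2) res unfolding abel_quadric_def by algebra
  finally show ?thesis .
qed

lemma DERIV_zero_interval_const:
  fixes h :: "real \<Rightarrow> real"
  assumes "\<And>x. x \<in> {a..b} \<Longrightarrow> (h has_real_derivative 0) (at x within {a..b})"
    and "x \<in> {a..b}" "z \<in> {a..b}"
  shows "h x = h z"
  using has_field_derivative_zero_constant[of "{a..b}" h] assms by (metis convex_real_interval(5))

text \<open>The logarithmic derivatives cancel: the weights 2, 3 * 2, -4 * 2 of
  \<open>p x * y x + q x * y x^2\<close> add up to 0, and so do the weights 3 * 4 and -4 * 3 of
  \<open>k x * y x\<close>. The quotient rule keeps the argument valid at zeros of
  \<open>y\<close>.\<close>

lemma abel_first_integral: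
  fixes y p q k F G :: "real \<Rightarrow> real"
  assumes y: "\<And>x. x \<in> {a..b} \<Longrightarrow> (y has_real_derivative p x * y x^2 + q x * y x^3) (at x within {a..b})"
    and F: "\<And>x. x \<in> {a..b} \<Longrightarrow> (F has_real_derivative
      (2 * (p x * y x + q x * y x^2) + 3 * k x * y x) * F x) (at x within {a..b})"
    and G: "\<And>x. x \<in> {a..b} \<Longrightarrow> (G has_real_derivative
      (2 * (p x * y x + q x * y x^2) + 4 * k x * y x) * G x) (at x within {a..b})"
    and nz: "\<And>x. x \<in> {a..b} \<Longrightarrow> F x \<noteq> 0"
    and st: "s \<in> {a..b}" "t \<in> {a..b}"
  shows "y s^2 * G s^3 / F s^4 = y t^2 * G t^3 / F t^4"
proof (rule DERIV_zero_interval_const[OF _ st])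
  fix x assume x: "x \<in> {a..b}"
  note [derivative_intros] = y[OF x] F[OF x] G[OF x]
  have "F x ^ 4 \<noteq> 0" using nz[OF x] by simp
  then show "((\<lambda>x. y x^2 * G x^3 / F x^4) has_real_derivative 0) (at x within {a..b})"
    by - (rule derivative_eq_intros refl | assumption | simp add: eval_nat_numeral algebra_simps)+
qed

section \<open>Obstruction to the composition condition\<close>

lemma tilde_pderiv: "tilde (poly (pderiv r)) a x = poly r x - poly r a"
proof -
  have *: "integral {c..d} (poly (pderiv r)) = poly r d - poly r c" if "c \<le> d" for c d :: real
    by (intro integral_unique fundamental_theorem_of_calculus that)
      (auto intro!: has_field_derivative_at_within poly_DERIV simp flip: has_real_derivative_iff_has_vector_derivative)
  show ?thesis by (simp add: tilde_def *)
qed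

lemma poly_degree_1_inj:
  fixes r :: "real poly"
  assumes "degree r = 1" "poly r x = poly r y"
  shows "x = y"
proof -
  obtain c d where "r = [:c, d:]" "d \<noteq> 0" using degree1_coeffs[OF assms(1)] by blast
  then show ?thesis using assms(2) by simp
qed

text \<open>Degrees multiply under composition, so a prime degree leaves an outer or an inner factor
  of degree 1; an inner one would be injective, against \<open>poly w a = poly w b\<close>.\<close>

lemma not_composition_conditionI:
  fixes P Q :: "real poly"
  assumes "prime (degree P)" "poly P c = poly P d" "poly Q c \<noteq> poly Q d" "a \<noteq> b"
  shows "\<not> composition_condition (pderiv P) (pderiv Q) a b"
proof
  assume "composition_condition (pderiv P) (pderiv Q) a b"
  then obtain w p1 q1 where w: "poly w a = poly w b"
    and P: "\<And>x. poly P x - poly P a = poly p1 (poly w x)"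
    and Q: "\<And>x. poly Q x - poly Q a = poly q1 (poly w x)"
    unfolding composition_condition_def tilde_pderiv by blast
  have "poly (P + [:- poly P a:]) = poly (pcompose p1 w)"
    by (auto simp: poly_pcompose simp flip: P)
  then have "P + [:- poly P a:] = pcompose p1 w"
    by (simp only: poly_eq_poly_eq_iff)
  moreover have "degree (P + [:- poly P a:]) = degree P"
    using prime_gt_0_nat[OF assms(1)] by (intro degree_add_eq_left) simp
  ultimately have "degree P = degree p1 * degree w"
    by (metis degree_pcompose)
  moreover have "degree w \<noteq> 1"
    using poly_degree_1_inj[OF _ w] assms(4) by blast
  ultimately have "degree p1 = 1"
    using assms(1) by (metis prime_product mult.commute)
  then have "poly w c = poly w d"
    using P[of c] P[of d] assms(2) by (metis poly_degree_1_inj)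
  then show False
    using Q[of c] Q[of d] assms(3) by simp
qed

section \<open>Existence and confinement of small solutions\<close>

text \<open>The bound \<open>M\<close> is available only while the solution stays within
  \<open>d\<close>, so the mean value theorem is applied up to the first exit time, the minimum of
  the compact set \<open>E\<close>.\<close>

lemma ode_solution_confined:
  fixes y :: "real \<Rightarrow> real"
  assumes y: "\<And>x. x \<in> {a..b} \<Longrightarrow> (y has_real_derivative f x (y x)) (at x within {a..b})"
    and M: "\<And>x v. x \<in> {a..b} \<Longrightarrow> \<bar>v\<bar> \<le> d \<Longrightarrow> \<bar>f x v\<bar> \<le> M"
    and d: "\<bar>y a\<bar> + M * (b - a) < d" and "0 \<le> M" and x: "x \<in> {a..b}"
  shows "\<bar>y x\<bar> < d"
proof (rule ccontr)
  assume "\<not> \<bar>y x\<bar> < d"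
  define E where "E = {a..b} \<inter> (\<lambda>x. \<bar>y x\<bar>) -` {d..}"
  have cont: "continuous_on {a..b} y"
    using y by (rule DERIV_continuous_on)
  have "closed E"
    unfolding E_def by (intro continuous_closed_preimage continuous_intros cont)
  moreover have "bounded E"
    unfolding E_def by (rule bounded_subset[of "{a..b}"]) auto
  ultimately have "compact E"
    by (simp add: compact_eq_bounded_closed)
  moreover have "E \<noteq> {}"
    using x \<open>\<not> \<bar>y x\<bar> < d\<close> by (auto simp: E_def)
  ultimately obtain s where s: "s \<in> E" "\<And>t. t \<in> E \<Longrightarrow> s \<le> t"
    using compact_attains_inf[of E] by blast
  have sab: "s \<in> {a..b}" and "d \<le> \<bar>y s\<bar>"
    using s(1) by (auto simp: E_def)
  moreover have "0 \<le> M * (b - a)"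
    using \<open>0 \<le> M\<close> x by simp
  ultimately have "a < s"
    using d by (cases "a = s") auto
  have "\<exists>z\<in>{a<..<s}. y s - y a = (s - a) * f z (y z)"
  proof (rule mvt_simple[where f' = "\<lambda>z h. h * f z (y z)", OF \<open>a < s\<close>])
    fix z assume z: "a \<le> z" "z \<le> s"
    have "(y has_real_derivative f z (y z)) (at z within {a..s})"
      using y[of z] z sab by (auto intro: DERIV_subset)
    then show "(y has_derivative (\<lambda>h. h * f z (y z))) (at z within {a..s})"
      by (simp add: has_field_derivative_def mult_commute_abs)
  qed
  then obtain z where z: "a < z" "z < s" "y s - y a = (s - a) * f z (y z)"
    by auto
  have "z \<notin> E"
    using s(2)[of z] z by auto
  then have "\<bar>y z\<bar> \<le> d"
    using z sab by (auto simp: E_def)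
  then have "\<bar>f z (y z)\<bar> \<le> M"
    using M z sab by auto
  then have "\<bar>y s - y a\<bar> \<le> (b - a) * M"
    unfolding z(3) abs_mult using \<open>a < s\<close> sab by (intro mult_mono) auto
  then show False
    using \<open>d \<le> \<bar>y s\<bar>\<close> d by (simp add: mult.commute)
qed

text \<open>Banach's fixed point theorem for the Picard operator on a ball of bounded continuous
  functions. The condition \<open>L * (b - a) < 1\<close> reaches \<open>b\<close> in one step,
  without gluing local solutions.\<close>

lemma picard_exists:
  fixes f :: "real \<Rightarrow> real \<Rightarrow> real"
  assumes "a \<le> b" "0 \<le> L" "L * (b - a) < 1" "0 \<le> d"
    and cont: "continuous_on ({a..b} \<times> {-d..d}) (\<lambda>(t, v). f t v)"
    and L: "\<And>t u v. t \<in> {a..b} \<Longrightarrow> \<bar>u\<bar> \<le> d \<Longrightarrow> \<bar>v\<bar> \<le> d \<Longrightarrow> \<bar>f t u - f t v\<bar> \<le> L * \<bar>u - v\<bar>"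
    and M: "\<And>t v. t \<in> {a..b} \<Longrightarrow> \<bar>v\<bar> \<le> d \<Longrightarrow> \<bar>f t v\<bar> \<le> M"
    and y0: "\<bar>y0\<bar> + M * (b - a) \<le> d"
  shows "\<exists>y. y a = y0 \<and> (\<forall>x\<in>{a..b}. (y has_real_derivative f x (y x)) (at x within {a..b}))"
proof -
  define S where "S = (cball 0 d :: (real \<Rightarrow>\<^sub>C real) set)"
  have S: "\<bar>\<phi> x\<bar> \<le> d" if "\<phi> \<in> S" for \<phi> x
    using norm_bounded[of \<phi> x] that by (auto simp: S_def)
  have "0 \<le> M" using M[of a 0] assms(1,4) by force
  \<comment> \<open>The functions in \<open>S\<close> live on the whole line; the retraction
    \<open>cl\<close> extends the Picard integral by constants outside
    \<open>{a..b}\<close>.\<close>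
  define cl where "cl x = max a (min b x)" for x :: real
  have cl: "cl x \<in> {a..b}" "x \<in> {a..b} \<Longrightarrow> cl x = x" for x
    using assms(1) by (auto simp: cl_def)
  define T where "T \<phi> x = y0 + integral {a..cl x} (\<lambda>t. f t (\<phi> t))" for \<phi> x
  have fcont: "continuous_on {a..b} (\<lambda>t. f t (\<phi> t))" if "\<phi> \<in> S" for \<phi>
  proof -
    have "continuous_on {a..b} (\<lambda>t. (t, apply_bcontfun \<phi> t))"
      by (intro continuous_intros) auto
    moreover have "(\<lambda>t. (t, apply_bcontfun \<phi> t)) ` {a..b} \<subseteq> {a..b} \<times> {-d..d}"
      using S[OF that] by (auto simp: abs_le_iff minus_le_iff)
    ultimately show ?thesis
      using continuous_on_compose2[OF cont] by fastforce
  qed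
  have fcont': "continuous_on {a..cl x} (\<lambda>t. f t (\<phi> t))" if "\<phi> \<in> S" for \<phi> x
    using fcont[OF that] by (rule continuous_on_subset) (use cl(1)[of x] in auto)
  have int_le: "\<bar>integral {a..cl x} g\<bar> \<le> B * (b - a)"
    if "continuous_on {a..cl x} g" "\<And>t. t \<in> {a..b} \<Longrightarrow> \<bar>g t\<bar> \<le> B" "0 \<le> B" for g B x
  proof -
    have "\<bar>integral {a..cl x} g\<bar> \<le> B * (cl x - a)"
      using integral_bound[of a "cl x" g B] that cl(1)[of x] by auto
    also have "\<dots> \<le> B * (b - a)"
      using cl(1)[of x] that(3) by (intro mult_left_mono) auto
    finally show ?thesis .
  qed
  have T_le: "\<bar>T \<phi> x\<bar> \<le> d" if "\<phi> \<in> S" for \<phi> x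
    using int_le[OF fcont'[OF that] M[OF _ S[OF that]] \<open>0 \<le> M\<close>, of x] y0 abs_triangle_ineq[of y0]
    unfolding T_def by (smt (verit))
  have T_cont: "continuous_on UNIV (T \<phi>)" if "\<phi> \<in> S" for \<phi>
  proof -
    have "continuous_on {a..b} (\<lambda>x. integral {a..x} (\<lambda>t. f t (\<phi> t)))"
      by (intro indefinite_integral_continuous_1 integrable_continuous_interval fcont that)
    moreover have "continuous_on UNIV cl"
      unfolding cl_def by (intro continuous_intros)
    ultimately have "continuous_on UNIV (\<lambda>x. integral {a..cl x} (\<lambda>t. f t (\<phi> t)))"
      by (rule continuous_on_compose2) (use cl(1) in auto)
    then show ?thesis unfolding T_def by (intro continuous_intros)
  qed
  \<comment> \<open>\<open>Bcontfun\<close> inverts \<open>apply_bcontfun\<close> only on bounded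
    continuous functions, hence the two facts about \<open>T\<close> above.\<close>
  have app: "apply_bcontfun (Bcontfun (T \<phi>)) = T \<phi>" if "\<phi> \<in> S" for \<phi>
    using T_cont[OF that] T_le[OF that] by (intro Bcontfun_inverse bcontfun_normI[of _ d]) auto
  have "\<exists>!\<phi>\<in>S. Bcontfun (T \<phi>) = \<phi>"
  proof (rule Banach_fix)
    show "complete S" "S \<noteq> {}" using \<open>0 \<le> d\<close> by (auto simp: S_def complete_eq_closed)
    show "0 \<le> L * (b - a)" "L * (b - a) < 1" using assms by auto
    show "(\<lambda>\<phi>. Bcontfun (T (apply_bcontfun \<phi>))) ` S \<subseteq> S"
      using T_le app by (auto simp: S_def intro!: norm_bound)
    fix \<phi> \<psi> assume S2: "\<phi> \<in> S" "\<psi> \<in> S"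
    show "dist (Bcontfun (T \<phi>)) (Bcontfun (T \<psi>)) \<le> L * (b - a) * dist \<phi> \<psi>"
    proof (rule dist_bound, unfold app[OF S2(1)] app[OF S2(2)])
      fix x
      have "T \<phi> x - T \<psi> x = integral {a..cl x} (\<lambda>t. f t (\<phi> t) - f t (\<psi> t))"
        unfolding T_def
        by (subst integral_diff) (auto intro!: integrable_continuous_interval fcont' S2)
      moreover have "\<bar>f t (\<phi> t) - f t (\<psi> t)\<bar> \<le> L * dist \<phi> \<psi>" if "t \<in> {a..b}" for t
        using L[OF that S[OF S2(1)] S[OF S2(2)], of t t] dist_bounded[of \<phi> t \<psi>] \<open>0 \<le> L\<close>
        by (smt (verit) dist_real_def mult_left_mono)
      ultimately have "\<bar>T \<phi> x - T \<psi> x\<bar> \<le> L * dist \<phi> \<psi> * (b - a)"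
        using \<open>0 \<le> L\<close> by (auto intro!: int_le continuous_intros fcont' S2)
      then show "dist (T \<phi> x) (T \<psi> x) \<le> L * (b - a) * dist \<phi> \<psi>"
        by (simp add: dist_real_def mult_ac)
    qed
  qed
  then obtain \<phi> where \<phi>: "\<phi> \<in> S" "Bcontfun (T \<phi>) = \<phi>" by blast
  then have T_fixpoint: "apply_bcontfun \<phi> x = T \<phi> x" for x using app by metis
  have "(\<phi> has_real_derivative f x (\<phi> x)) (at x within {a..b})" if x: "x \<in> {a..b}" for x
  proof (rule has_field_derivative_transform_within[OF _ zero_less_one x])
    show "y0 + integral {a..t} (\<lambda>t. f t (\<phi> t)) = apply_bcontfun \<phi> t" if "t \<in> {a..b}" for t
      using T_fixpoint[of t] cl(2)[OF that] by (simp add: T_def)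
    show "((\<lambda>t. y0 + integral {a..t} (\<lambda>t. f t (\<phi> t))) has_real_derivative f x (\<phi> x)) (at x within {a..b})"
      using integral_has_real_derivative[OF fcont[OF \<phi>(1)] x]
      by (auto intro!: derivative_eq_intros)
  qed
  moreover have "\<phi> a = y0"
    using T_fixpoint[of a] cl(2)[of a] \<open>a \<le> b\<close> by (simp add: T_def)
  ultimately show ?thesis by blast
qed

text \<open>The right-hand side is quadratically small in \<open>y\<close>, so its Lipschitz
  constant on \<open>\<bar>v\<bar> \<le> d\<close> tends to 0 with \<open>d\<close> and a fixed
  interval is short enough. Confinement covers every solution, as \<open>abel_center\<close>
  quantifies over all of them.\<close>

lemma abel_small_solutions:
  fixes p q :: "real poly"
  assumes "a \<le> b" "0 < r"
  shows "\<exists>\<epsilon>>0. \<forall>y0. \<bar>y0\<bar> < \<epsilon> \<longrightarrow>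
    (\<exists>y. abel_solution_on p q a b y \<and> y a = y0) \<and>
    (\<forall>y. abel_solution_on p q a b y \<and> y a = y0 \<longrightarrow> (\<forall>x\<in>{a..b}. \<bar>y x\<bar> < r))"
proof -
  have "bounded (poly p ` {a..b} \<union> poly q ` {a..b})"
    by (auto intro!: compact_imp_bounded compact_continuous_image continuous_intros)
  then obtain B where "0 < B" and B: "\<And>x. x \<in> {a..b} \<Longrightarrow> \<bar>poly p x\<bar> \<le> B"
      "\<And>x. x \<in> {a..b} \<Longrightarrow> \<bar>poly q x\<bar> \<le> B"
    unfolding bounded_pos by auto
  \<comment> \<open>The 20 makes the contraction factor \<open>5 * B * d * (b - a)\<close> at most
    1/4 and the drift \<open>2 * B * d^2 * (b - a)\<close> at most \<open>d / 10\<close>. The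
    \<open>+ 1\<close> keeps the denominator positive when \<open>a = b\<close>;
    \<open>d \<le> 1\<close> bounds cubic terms by quadratic ones.\<close>
  define d where "d = min r (min 1 (1 / (20 * B * (b - a + 1))))"
  have d: "0 < d" "d \<le> r" "d \<le> 1"
    using assms \<open>0 < B\<close> by (auto simp: d_def)
  have "0 < 20 * B * (b - a + 1)"
    using assms \<open>0 < B\<close> by simp
  moreover have "d \<le> 1 / (20 * B * (b - a + 1))"
    by (simp add: d_def)
  ultimately have "d * (20 * B * (b - a + 1)) \<le> 1"
    by (simp only: pos_le_divide_eq)
  moreover have "0 \<le> d * (20 * B)"
    using d \<open>0 < B\<close> by simp
  ultimately have Bd: "B * d * (b - a) \<le> 1 / 20"
    by (simp add: algebra_simps)
  define f where "f t v = poly p t * v^2 + poly q t * v^3" for t v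
  have M: "\<bar>f t v\<bar> \<le> 2 * B * d^2" if "t \<in> {a..b}" "\<bar>v\<bar> \<le> d" for t v
  proof -
    have v: "\<bar>v\<bar>^2 \<le> d^2" "\<bar>v\<bar>^3 \<le> d^3"
      by (rule power_mono[OF that(2)]; simp)+
    moreover have "d^3 \<le> d^2"
      using d by (intro power_decreasing) auto
    ultimately have "\<bar>poly p t * v^2\<bar> \<le> B * d^2" "\<bar>poly q t * v^3\<bar> \<le> B * d^2"
      using B[OF that(1)] \<open>0 < B\<close> by (auto simp: abs_mult power_abs intro!: mult_mono)
    then show ?thesis
      unfolding f_def by linarith
  qed
  have L: "\<bar>f t u - f t v\<bar> \<le> 5 * B * d * \<bar>u - v\<bar>"
    if "t \<in> {a..b}" "\<bar>u\<bar> \<le> d" "\<bar>v\<bar> \<le> d" for t u v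
  proof -
    have sq: "\<bar>u * u\<bar> \<le> d" "\<bar>u * v\<bar> \<le> d" "\<bar>v * v\<bar> \<le> d"
      using mult_mono[of "\<bar>u\<bar>" d "\<bar>u\<bar>" 1] mult_mono[of "\<bar>u\<bar>" d "\<bar>v\<bar>" 1]
        mult_mono[of "\<bar>v\<bar>" d "\<bar>v\<bar>" 1] that d by (auto simp: abs_mult)
    then have sum_le: "\<bar>u * u + u * v + v * v\<bar> \<le> 3 * d"
      by linarith
    have "\<bar>poly p t * (u + v)\<bar> \<le> B * (2 * d)"
      unfolding abs_mult using B[OF that(1)] \<open>0 < B\<close> that by (intro mult_mono) auto
    moreover have "\<bar>poly q t * (u * u + u * v + v * v)\<bar> \<le> B * (3 * d)"
      unfolding abs_mult[of "poly q t"] using B[OF that(1)] \<open>0 < B\<close> sum_le by (intro mult_mono) auto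
    ultimately have "\<bar>poly p t * (u + v) + poly q t * (u * u + u * v + v * v)\<bar> \<le> 5 * B * d"
      by linarith
    moreover have "f t u - f t v = (poly p t * (u + v) + poly q t * (u * u + u * v + v * v)) * (u - v)"
      unfolding f_def by algebra
    ultimately show ?thesis
      by (simp add: abs_mult mult_right_mono)
  qed
  have y0: "\<bar>y0\<bar> + 2 * B * d^2 * (b - a) < d" if "\<bar>y0\<bar> < d / 2" for y0
  proof -
    have "2 * B * d^2 * (b - a) = 2 * d * (B * d * (b - a))"
      by (simp add: power2_eq_square)
    also have "\<dots> \<le> 2 * d * (1 / 20)"
      using d by (intro mult_left_mono Bd) auto
    finally show ?thesis
      using that d by linarith
  qed
  have sol: "abel_solution_on p q a b y \<longleftrightarrow>
      (\<forall>x\<in>{a..b}. (y has_real_derivative f x (y x)) (at x within {a..b}))" for y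
    by (simp add: abel_solution_on_def f_def)
  show ?thesis
  proof (intro exI[of _ "d / 2"] conjI allI impI ballI)
    fix y0 assume y0': "\<bar>y0\<bar> < d / 2"
    have "\<exists>y. y a = y0 \<and> (\<forall>x\<in>{a..b}. (y has_real_derivative f x (y x)) (at x within {a..b}))"
    proof (rule picard_exists[OF \<open>a \<le> b\<close> _ _ _ _ L M])
      show "continuous_on ({a..b} \<times> {-d..d}) (\<lambda>(t, v). f t v)"
        unfolding f_def case_prod_beta by (intro continuous_intros)
    qed (use d Bd \<open>0 < B\<close> y0[OF y0'] in auto)
    then show "\<exists>y. abel_solution_on p q a b y \<and> y a = y0"
      unfolding sol by blast
  next
    fix y0 y x assume "\<bar>y0\<bar> < d / 2" "abel_solution_on p q a b y \<and> y a = y0" "x \<in> {a..b}"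
    then have "\<bar>y x\<bar> < d"
      using y0 \<open>0 < B\<close> unfolding sol by (intro ode_solution_confined[of a b y f d, OF _ M]) auto
    then show "\<bar>y x\<bar> < r"
      using d by simp
  qed (use d in auto)
qed

section \<open>Bounds that keep the denominator of the first integral away from zero\<close>

text \<open>The square dominates: with \<open>w = \<bar>1 + P x * y\<bar> \<ge> 3 / 4\<close> the
  value is at least 3w/4 - w/4 - 1/16 > 0.\<close>

lemma abel_quadric_nonzero:
  assumes "\<bar>P x\<bar> \<le> K" "\<bar>A x\<bar> \<le> K" "\<bar>C x\<bar> \<le> K" "\<bar>y\<bar> < 1 / (4 * K)" "1 \<le> K"
  shows "abel_quadric P A C x y \<noteq> 0"
proof -
  have y: "K * \<bar>y\<bar> < 1 / 4"
    using assms(4,5) by (simp add: field_simps)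
  have 1: "\<bar>P x * y\<bar> < 1 / 4" "\<bar>A x * y\<bar> < 1 / 4" "\<bar>C x * y\<bar> < 1 / 4"
    using y assms(1-3) unfolding abs_mult by (meson abs_ge_zero le_less_trans mult_right_mono)+
  have "\<bar>y\<bar> \<le> K * \<bar>y\<bar>"
    using assms(5) by (simp add: mult_le_cancel_right1)
  then have "\<bar>y\<bar> \<le> 1 / 4" using y by linarith
  then have "\<bar>C x * y * y\<bar> \<le> 1 / 4 * (1 / 4)"
    unfolding abs_mult[of _ y] using 1 by (intro mult_mono) (auto simp: abs_mult)
  then have C: "- 1 / 16 \<le> C x * y^2"
    by (simp add: power2_eq_square)
  define w where "w = \<bar>1 + P x * y\<bar>"
  have w: "3 / 4 \<le> w"
    using 1 by (auto simp: w_def)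
  have "\<bar>A x * y * (1 + P x * y)\<bar> \<le> 1 / 4 * w"
    unfolding abs_mult[of _ "1 + _"] w_def using 1 by (intro mult_right_mono) auto
  then have A: "- (1 / 4 * w) \<le> A x * y * (1 + P x * y)"
    by linarith
  have "3 / 4 * w \<le> w * w"
    using w by (intro mult_right_mono) auto
  also have "w * w = (1 + P x * y)^2"
    by (simp add: w_def power2_eq_square)
  finally have "0 < abel_quadric P A C x y"
    unfolding abel_quadric_def using A C w by linarith
  then show ?thesis by simp
qed

lemma abs_poly_le_sum_abs_coeffs:
  fixes r :: "real poly"
  assumes "\<bar>x\<bar> \<le> 1"
  shows "\<bar>poly r x\<bar> \<le> (\<Sum>c\<leftarrow>coeffs r. \<bar>c\<bar>)"
proof (induction r)
  case (pCons c r)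
  have "\<bar>x * poly r x\<bar> \<le> 1 * \<bar>poly r x\<bar>"
    unfolding abs_mult using assms by (intro mult_right_mono) auto
  then have "\<bar>poly (pCons c r) x\<bar> \<le> \<bar>c\<bar> + (\<Sum>c\<leftarrow>coeffs r. \<bar>c\<bar>)"
    using pCons.IH by simp
  then show ?case
    using pCons.hyps by (simp add: cCons_def)
qed simp

section \<open>The given equation\<close>

theorem theorem2:
  fixes p q :: "real poly"
  assumes "p = [:2, 0, -30, 0, 40:]"
    and "q = [:0, -3, 0, -10, 0, 88, 0, -150, 0, 75:]"
  shows "abel_center p q (-1) 1 \<and> \<not> composition_condition p q (-1) 1"
proof
  define P :: "real poly" where "P = [:0, 2, 0, -10, 0, 8:]"
  \<comment> \<open>This primitive is normalised at 0, not at -1; only differences of its values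
    matter.\<close>
  define Q :: "real poly" where "Q = [:0, 0, -3/2, 0, -5/2, 0, 44/3, 0, -75/4, 0, 15/2:]"
  have p: "p = pderiv P" and q: "q = pderiv Q"
    unfolding assms P_def Q_def by (simp_all add: pderiv_pCons)
  have "degree P = 5"
    by (simp add: P_def)
  then have "prime (degree P)"
    by simp
  \<comment> \<open>\<open>P\<close> vanishes at both 0 and 1, while \<open>Q\<close> is 0 at 0 and
    -7/12 at 1.\<close>
  then show "\<not> composition_condition p q (-1) 1"
    unfolding p q by (rule not_composition_conditionI[of _ 0 1]) (auto simp: P_def Q_def)

  \<comment> \<open>Primitives of the cofactors \<open>3 * k x\<close> and \<open>4 * k x\<close>,
    then of the right-hand sides required for \<open>C'\<close>; the constants 2/3 and 1/2 are
    forced by the \<open>x^2\<close> coefficient of the last hypothesis of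
    \<open>abel_quadric_invariant\<close>.\<close>
  define A\<^sub>1 A\<^sub>2 C\<^sub>1 C\<^sub>2 :: "real poly"
    where "A\<^sub>1 = [:0, 0, 0, 6, 0, -6:]" and "A\<^sub>2 = [:0, 0, 0, 8, 0, -8:]"
      and "C\<^sub>1 = [:2/3, 0, -3, 0, 4, 0, 22/3, 0, -18, 0, 9:]"
      and "C\<^sub>2 = [:1/2, 0, -3, 0, 7, 0, 8, 0, -55/2, 0, 15:]"
  note defs = P_def Q_def A\<^sub>1_def A\<^sub>2_def C\<^sub>1_def C\<^sub>2_def
  define F where "F = abel_quadric (poly P) (poly A\<^sub>1) (poly C\<^sub>1)"
  define G where "G = abel_quadric (poly P) (poly A\<^sub>2) (poly C\<^sub>2)"
  define k where "k x = 6 * x^2 - 10 * x^4" for x :: real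
  have F: "((\<lambda>x. F x (y x)) has_real_derivative
       (2 * (poly p x * y x + poly q x * y x^2) + 3 * k x * y x) * F x (y x)) (at x within S)"
    if "(y has_real_derivative poly p x * y x^2 + poly q x * y x^3) (at x within S)" for y x S
    unfolding F_def
  proof (rule abel_quadric_invariant[OF that])
    show "poly (pderiv C\<^sub>1) x = 3 * k x * (poly P x + poly A\<^sub>1 x) + 2 * poly q x"
      unfolding q defs k_def by (simp add: pderiv_pCons) algebra
    show "poly P x * poly (pderiv C\<^sub>1) x + poly q x * poly A\<^sub>1 x + 3 * k x * poly C\<^sub>1 x = 0"
      unfolding q defs k_def by (simp add: pderiv_pCons) algebra
    have "3 * k x = poly (pderiv A\<^sub>1) x"
      unfolding defs k_def by (simp add: pderiv_pCons) algebra
    then show "(poly A\<^sub>1 has_real_derivative 3 * k x) (at x within S)"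
      by (simp add: poly_DERIV has_field_derivative_at_within)
  qed (auto simp: p intro!: has_field_derivative_at_within poly_DERIV)
  have G: "((\<lambda>x. G x (y x)) has_real_derivative
       (2 * (poly p x * y x + poly q x * y x^2) + 4 * k x * y x) * G x (y x)) (at x within S)"
    if "(y has_real_derivative poly p x * y x^2 + poly q x * y x^3) (at x within S)" for y x S
    unfolding G_def
  proof (rule abel_quadric_invariant[OF that])
    show "poly (pderiv C\<^sub>2) x = 4 * k x * (poly P x + poly A\<^sub>2 x) + 2 * poly q x"
      unfolding q defs k_def by (simp add: pderiv_pCons) algebra
    show "poly P x * poly (pderiv C\<^sub>2) x + poly q x * poly A\<^sub>2 x + 4 * k x * poly C\<^sub>2 x = 0"
      unfolding q defs k_def by (simp add: pderiv_pCons) algebra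
    have "4 * k x = poly (pderiv A\<^sub>2) x"
      unfolding defs k_def by (simp add: pderiv_pCons) algebra
    then show "(poly A\<^sub>2 has_real_derivative 4 * k x) (at x within S)"
      by (simp add: poly_DERIV has_field_derivative_at_within)
  qed (auto simp: p intro!: has_field_derivative_at_within poly_DERIV)
  \<comment> \<open>Only \<open>F\<close> occurs in a denominator. The sums of absolute coefficients
    are 20, 12 and 42, and 1/200 is \<open>1 / (4 * K)\<close> for \<open>K = 50\<close>.\<close>
  have bounds: "\<bar>poly P x\<bar> \<le> 50" "\<bar>poly A\<^sub>1 x\<bar> \<le> 50" "\<bar>poly C\<^sub>1 x\<bar> \<le> 50" if "x \<in> {-1..1}" for x
    using that abs_poly_le_sum_abs_coeffs[of x P] abs_poly_le_sum_abs_coeffs[of x A\<^sub>1]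
      abs_poly_le_sum_abs_coeffs[of x C\<^sub>1]
    unfolding defs by (simp_all del: poly_pCons add: abs_le_iff)
  have F_nz: "F x y \<noteq> 0" if "x \<in> {-1..1}" "\<bar>y\<bar> < 1 / 200" for x y
    unfolding F_def using bounds[OF that(1)] that(2) by (intro abel_quadric_nonzero[of _ _ 50]) auto
  have ends: "F (-1) y = 1" "F 1 y = 1" "G (-1) y = 1" "G 1 y = 1" for y
    by (simp_all add: F_def G_def abel_quadric_def defs)

  have return: "y 1 = y (-1)"
    if sol: "abel_solution_on p q (-1) 1 y" and small: "\<forall>x\<in>{-1..1}. \<bar>y x\<bar> < 1 / 200" for y
  proof (rule ccontr)
    assume neq: "y 1 \<noteq> y (-1)"
    have der: "(y has_real_derivative poly p x * y x^2 + poly q x * y x^3) (at x within {-1..1})"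
      if "x \<in> {-1..1}" for x
      using sol that by (simp add: abel_solution_on_def)
    have const: "y s^2 * G s (y s)^3 / F s (y s)^4 = y t^2 * G t (y t)^3 / F t (y t)^4"
      if "s \<in> {-1..1}" "t \<in> {-1..1}" for s t
      using abel_first_integral[of "-1" 1 y "poly p" "poly q" "\<lambda>x. F x (y x)" k "\<lambda>x. G x (y x)" s t]
        der F[OF der] G[OF der] F_nz small that by blast
    from const[of 1 "-1"] have "y 1^2 = y (-1)^2"
      by (simp add: ends)
    then have opp: "y 1 = - y (-1)"
      using neq by (auto simp: power2_eq_iff)
    have "continuous_on {-1..1} y"
      by (rule DERIV_continuous_on[OF der])
    then obtain z where z: "z \<in> {-1..1}" "y z = 0"
      using IVT'[of y "-1" 0 1] IVT2'[of y 1 0 "-1"] opp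
      by (cases "y (-1) \<le> 0") auto
    \<comment> \<open>The first integral is 0 at \<open>z\<close> and \<open>y (-1)^2\<close> at
      -1.\<close>
    from const[of z "-1"] z have "y (-1) = 0"
      by (simp add: ends)
    then show False
      using opp neq by simp
  qed
  obtain \<epsilon> where "0 < \<epsilon>" and small: "\<And>y0. \<bar>y0\<bar> < \<epsilon> \<Longrightarrow>
      (\<exists>y. abel_solution_on p q (-1) 1 y \<and> y (-1) = y0) \<and>
      (\<forall>y. abel_solution_on p q (-1) 1 y \<and> y (-1) = y0 \<longrightarrow> (\<forall>x\<in>{-1..1}. \<bar>y x\<bar> < 1 / 200))"
    using abel_small_solutions[of "-1" 1 "1 / 200" p q] by auto
  show "abel_center p q (-1) 1"
    unfolding abel_center_def
  proof (intro exI[of _ \<epsilon>] conjI allI impI \<open>0 < \<epsilon>\<close>)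
    fix y0 assume y0: "\<bar>y0\<bar> < \<epsilon>"
    show "\<exists>y. abel_solution_on p q (-1) 1 y \<and> y (-1) = y0"
      using small[OF y0] by (rule conjunct1)
    fix y assume "abel_solution_on p q (-1) 1 y \<and> y (-1) = y0"
    with small[OF y0] show "y 1 = y (-1)"
      by (intro return) blast+
  qed
qed

end
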